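(* For each integer $r\ge0$ let \[ A_r(q)=\sum_{n\ge0}a_2(n;r)q^n,\qquad B_r(q)=\sum_{n\ge0}b_2(n;r)q^n . \] Then, as formal power series in $q$, \[ A_0(q)=B_0(q)=\frac{q^3}{(1-q)(1-q^3)}, \] and for every integer $r\ge1$, \[ (1+q^2)B_r(q)=(1+q)A_r(q). \] Equivalently, for every $r\ge1$ and every integer $n\ge0$, \[ b_2(n;r)+b_2(n-2;r)=a_2(n;r)+a_2(n-1;r), \] where $a_2(m;r)=b_2(m;r)=0$ for $m<0$.
   Context: Notation: $(x;q^2)_0=1$ and $(x;q^2)_n=\prod_{j=0}^{n-1}(1-xq^{2j})$. Let $a_2(n;r)$ be the number of partitions of $n$ for which there are integers $l\ge 2$, $1\le k\le l-1$ such that: there are exactly $l-1$ parts equal to $1$; the smallest even part is $2k$; every part greater than $1$ lies in the interval $[2k,2l-2]$; the odd parts greater than $1$ are distinct; and the number of parts greater than $1$, other than one compulsory copy of the smallest even part $2k$, is $r$. Let $b_2(n;r)$ be defined in the same way with the interval $[2k,2l-2]$ replaced by $[2k,2l-1]$. Equivalently, \[ \sum_{n,r\ge0}a_2(n;r)z^rq^n=\sum_{\substack{l\ge2\\1\le k\le l-1}}\frac{(-zq^{2k+1};q^2)_{l-k-1}}{(zq^{2k};q^2)_{l-k}}q^{2k+l-1},\qquad \sum_{n,r\ge0}b_2(n;r)z^rq^n=\sum_{\substack{l\ge2\\1\le k\le l-1}}\frac{(-zq^{2k+1};q^2)_{l-k}}{(zq^{2k};q^2)_{l-k}}q^{2k+l-1}.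 \] *)

theory Defs
  imports
    "HOL-Library.Multiset"
    "HOL-Computational_Algebra.Formal_Power_Series"
begin

definition partitions_of :: "nat \<Rightarrow> nat multiset set" where
  "partitions_of n = {M. 0 \<notin># M \<and> \<Sum>\<^sub># M = n}"

text \<open>
  The condition shared by both counting functions, for given \<open>l\<close> and \<open>k\<close>; the upper bound \<open>u\<close> on
  the parts will be \<open>2l - 2\<close> or \<open>2l - 1\<close>. In the last conjunct, \<open>Suc\<close> accounts for the one
  compulsory copy of \<open>2k\<close>, which \<open>r\<close> does not count.
\<close>

definition admissible :: "nat \<Rightarrow> nat \<Rightarrow> nat \<Rightarrow> nat \<Rightarrow> nat multiset \<Rightarrow> bool" where
  "admissible l k u r M \<longleftrightarrow>
     count M 1 = l - 1 \<and>
     2 * k \<in># M \<and> (\<forall>p\<in>#M. even p \<longrightarrow> 2 * k \<le> p) \<and>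
     (\<forall>p\<in>#M. p > 1 \<longrightarrow> p \<in> {2 * k..u}) \<and>
     (\<forall>p\<in>#M. odd p \<and> p > 1 \<longrightarrow> count M p = 1) \<and>
     size {#p \<in># M. p > 1#} = Suc r"

definition a2 :: "nat \<Rightarrow> nat \<Rightarrow> nat" where
  "a2 n r = card {M \<in> partitions_of n.
     \<exists>l k. l \<ge> 2 \<and> 1 \<le> k \<and> k \<le> l - 1 \<and> admissible l k (2 * l - 2) r M}"

definition b2 :: "nat \<Rightarrow> nat \<Rightarrow> nat" where
  "b2 n r = card {M \<in> partitions_of n.
     \<exists>l k. l \<ge> 2 \<and> 1 \<le> k \<and> k \<le> l - 1 \<and> admissible l k (2 * l - 1) r M}"

text \<open>Extension by zero to negative arguments.\<close>

definition a2_int :: "int \<Rightarrow> nat \<Rightarrow> nat" where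
  "a2_int m r = (if m < 0 then 0 else a2 (nat m) r)"

definition b2_int :: "int \<Rightarrow> nat \<Rightarrow> nat" where
  "b2_int m r = (if m < 0 then 0 else b2 (nat m) r)"

text \<open>The coefficients are integers; they are taken in \<open>rat\<close> so that power series can be divided.\<close>

definition A :: "nat \<Rightarrow> rat fps" where
  "A r = Abs_fps (\<lambda>n. of_nat (a2 n r))"

definition B :: "nat \<Rightarrow> rat fps" where
  "B r = Abs_fps (\<lambda>n. of_nat (b2 n r))"

text \<open>The sets counted by \<open>a2\<close> and \<open>b2\<close> are finite, so \<open>card\<close> is meaningful.\<close>

lemma finite_partitions_of: "finite (partitions_of n)"
proof -
  have sz: "size M \<le> \<Sum>\<^sub># M" if "0 \<notin># M" for M :: "nat multiset"
    using that by (induction M) auto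
  have "partitions_of n \<subseteq> (\<lambda>xs. mset xs) ` {xs. set xs \<subseteq> {..n} \<and> length xs \<le> n}"
  proof
    fix M assume M: "M \<in> partitions_of n"
    obtain xs where xs: "M = mset xs" by (metis ex_mset)
    have "length xs \<le> n"
      using sz[of M] M xs by (auto simp: partitions_of_def)
    moreover have "set xs \<subseteq> {..n}"
      using M xs by (auto simp: partitions_of_def sum_mset_sum_list member_le_sum_list)
    ultimately show "M \<in> (\<lambda>xs. mset xs) ` {xs. set xs \<subseteq> {..n} \<and> length xs \<le> n}"
      using xs by auto
  qed
  then show ?thesis
    by (rule finite_subset) (simp add: finite_lists_length_le)
qed

end

theory Submission
  imports Defs
begin

text \<open>
  Let \<open>c\<close> be the number of ones of a partition, so that \<open>l = c + 1\<close> and the largest admitted part is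
  \<open>2c\<close> for \<open>a2\<close> and \<open>2c + 1\<close> for \<open>b2\<close>. For \<open>r \<ge> 1\<close>, both sides of the coefficient identity are
  compared through one auxiliary family, \<open>stem_set\<close>: the partitions that become members of the
  \<open>b2\<close>-family when the part \<open>2c + 1\<close> is added.

  A partition counted by \<open>b2 n r\<close> either avoids \<open>2c + 1\<close>, and is then counted by \<open>a2 n r\<close>, or it
  contains \<open>2c + 1\<close> once. In the second case this part can be lowered to \<open>2c\<close>, which gives a
  partition of \<open>n - 1\<close> in the \<open>a2\<close>-family that contains \<open>2c\<close> besides the compulsory copy of
  \<open>2k\<close>. The only partition in the \<open>a2\<close>-family with \<open>2c\<close> as a part but with nothing else to serve as
  the compulsory part consists of \<open>2c\<close> and \<open>c\<close> ones, and has \<open>r = 0\<close>. So for \<open>r \<ge> 1\<close> the partitions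
  of \<open>n - 1\<close> not reached are those that avoid \<open>2c\<close>; their parts are at most \<open>2c - 1 = 2(c - 1) + 1\<close>,
  and removing a one gives exactly the partitions counted by \<open>b2 (n - 2) r\<close>. In symbols,
  \<open>b2 n = a2 n + s n\<close> and \<open>a2 (n - 1) = b2 (n - 2) + s n\<close> where \<open>s\<close> counts stems
  (\<open>b2_eq_a2_plus_stem\<close>, \<open>a2_eq_b2_plus_stem\<close>), and eliminating \<open>s\<close> gives the claim.

  On generating functions this is the telescoping
  \<open>(1 + q) u\<^sub>m / (1 - xq\<^bsup>2m\<^esup>) = u\<^sub>m\<^sub>+\<^sub>1 + q u\<^sub>m\<close> for
  \<open>u\<^sub>m = (-xq; q\<^sup>2)\<^sub>m / (x; q\<^sup>2)\<^sub>m\<close> with \<open>x = zq\<^bsup>2k\<^esup>\<close>: for fixed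
  \<open>k\<close> and \<open>m = l - k - 1\<close>, the quotient on the left belongs to the \<open>a2\<close>-family for \<open>l\<close>, and \<open>u\<^sub>m\<^sub>+\<^sub>1\<close> and
  \<open>u\<^sub>m\<close> belong to the \<open>b2\<close>-families for \<open>l\<close> and \<open>l - 1\<close>. For \<open>m = 0\<close> there is no
  \<open>b2\<close>-family for \<open>l - 1 = k\<close>, but \<open>u\<^sub>0 = 1\<close> affects only the coefficients with \<open>r = 0\<close>.

  For \<open>r = 0\<close> the partitions consist of \<open>2k\<close> and \<open>n - 2k\<close> ones with \<open>1 \<le> k \<le> n - 2k\<close>. There are
  \<open>n div 3\<close> of them, and the stated quotient is the generating function of \<open>n div 3\<close>.
\<close>

section \<open>The two families without the parameter l\<close>

text \<open>
  The part \<open>1\<close> occurs exactly \<open>l - 1\<close> times, so \<open>l\<close> can be read off from the partition, and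
  \<open>k \<le> l - 1\<close> becomes \<open>k \<le> count M 1\<close>. As \<open>0\<close> is not a part, every even part exceeds \<open>1\<close>; so
  \<open>2 * k \<le> p\<close> for all parts \<open>p > 1\<close> also says that \<open>2 * k\<close> is the smallest even part.
\<close>

definition shape :: "nat \<Rightarrow> nat \<Rightarrow> nat \<Rightarrow> nat multiset \<Rightarrow> bool" where
  "shape k u r M \<longleftrightarrow> 0 \<notin># M \<and> 1 \<le> k \<and> k \<le> count M 1 \<and> 2 * k \<in># M \<and>
     (\<forall>p\<in>#M. p > 1 \<longrightarrow> 2 * k \<le> p \<and> p \<le> u \<and> (odd p \<longrightarrow> count M p = 1)) \<and>
     size {#p \<in># M. p > 1#} = Suc r"

definition A_set :: "nat \<Rightarrow> nat \<Rightarrow> nat multiset set" where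
  "A_set n r = {M. \<Sum>\<^sub># M = n \<and> (\<exists>k. shape k (2 * count M 1) r M)}"

definition B_set :: "nat \<Rightarrow> nat \<Rightarrow> nat multiset set" where
  "B_set n r = {M. \<Sum>\<^sub># M = n \<and> (\<exists>k. shape k (2 * count M 1 + 1) r M)}"

lemma admissible_iff_shape:
  assumes "0 \<notin># M" "1 \<le> k" "k \<le> c"
  shows "admissible (Suc c) k u r M \<longleftrightarrow> count M 1 = c \<and> shape k u r M"
proof -
  have "p > 1" if "p \<in># M" "even p" for p
    using assms(1) that by (cases p) (auto elim: oddE intro: Suc_lessI)
  then show ?thesis
    using assms by (auto simp: admissible_def shape_def)
qed

lemma shape_count_1: "shape k u r M \<Longrightarrow> count M 1 \<ge> 1"
  unfolding shape_def by linarith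

lemma shape_zero_notin: "shape k u r M \<Longrightarrow> 0 \<notin># M"
  unfolding shape_def by blast

lemma ex_admissible_iff_ex_shape:
  assumes nz: "0 \<notin># M" and u: "\<And>c. u (Suc c) = f c"
  shows "(\<exists>l k. l \<ge> 2 \<and> 1 \<le> k \<and> k \<le> l - 1 \<and> admissible l k (u l) r M)
      \<longleftrightarrow> (\<exists>k. shape k (f (count M 1)) r M)" (is "?L \<longleftrightarrow> ?R")
proof
  assume ?L
  then obtain l k where lk: "l \<ge> 2" "1 \<le> k" "k \<le> l - 1" "admissible l k (u l) r M"
    by blast
  moreover from lk(1) have "l = Suc (l - 1)" by simp
  ultimately have "admissible (Suc (l - 1)) k (f (l - 1)) r M"
    using u by metis
  then show ?R
    using admissible_iff_shape[OF nz lk(2,3)] by metis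
next
  assume ?R
  then obtain k where k: "shape k (f (count M 1)) r M" by blast
  then have k': "1 \<le> k" "k \<le> count M 1" by (simp_all add: shape_def)
  have "admissible (Suc (count M 1)) k (u (Suc (count M 1))) r M"
    using admissible_iff_shape[OF nz k'] k u by metis
  moreover have "2 \<le> Suc (count M 1)" "k \<le> Suc (count M 1) - 1"
    using k' by linarith+
  ultimately show ?L
    using k'(1) by blast
qed

lemma a2_eq_card: "a2 n r = card (A_set n r)"
proof -
  have "{M \<in> partitions_of n. \<exists>l k. l \<ge> 2 \<and> 1 \<le> k \<and> k \<le> l - 1 \<and> admissible l k (2 * l - 2) r M}
      = A_set n r"
    using ex_admissible_iff_ex_shape[of _ "\<lambda>l. 2 * l - 2" "\<lambda>c. 2 * c" r] shape_zero_notin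
    unfolding A_set_def partitions_of_def by (intro Collect_cong) auto
  then show ?thesis by (simp add: a2_def)
qed

lemma b2_eq_card: "b2 n r = card (B_set n r)"
proof -
  have "{M \<in> partitions_of n. \<exists>l k. l \<ge> 2 \<and> 1 \<le> k \<and> k \<le> l - 1 \<and> admissible l k (2 * l - 1) r M}
      = B_set n r"
    using ex_admissible_iff_ex_shape[of _ "\<lambda>l. 2 * l - 1" "\<lambda>c. 2 * c + 1" r] shape_zero_notin
    unfolding B_set_def partitions_of_def by (intro Collect_cong) auto
  then show ?thesis by (simp add: b2_def)
qed

lemma finite_A_set: "finite (A_set n r)"
  by (rule finite_subset[OF _ finite_partitions_of[of n]])
     (auto simp: A_set_def shape_def partitions_of_def)

lemma finite_B_set: "finite (B_set n r)"
  by (rule finite_subset[OF _ finite_partitions_of[of n]])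
     (auto simp: B_set_def shape_def partitions_of_def)

lemma shape_sum_ge_3:
  assumes "shape k u r M"
  shows "\<Sum>\<^sub># M \<ge> 3"
proof -
  have "1 \<in># M" "2 * k \<in># M" "k \<ge> 1"
    using assms by (auto simp: shape_def simp flip: count_greater_zero_iff)
  then obtain N where "M = add_mset (2 * k) N" "1 \<in># N"
    by (metis insert_DiffM insert_noteq_member even_mult_iff odd_one even_numeral)
  then obtain P where "M = add_mset (2 * k) (add_mset 1 P)"
    by (metis insert_DiffM)
  with \<open>k \<ge> 1\<close> show ?thesis by simp
qed

lemma a2_eq_0: "n < 3 \<Longrightarrow> a2 n r = 0"
  using finite_A_set[of n r] by (auto simp: a2_eq_card A_set_def dest: shape_sum_ge_3)

lemma b2_eq_0: "n < 3 \<Longrightarrow> b2 n r = 0"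
  using finite_B_set[of n r] by (auto simp: b2_eq_card B_set_def dest: shape_sum_ge_3)


section \<open>Lowering the largest odd part\<close>

text \<open>
  Raising one copy of \<open>2 * c\<close> to \<open>2 * c + 1\<close> preserves every condition except that it may destroy the
  only copy of \<open>2 * k\<close>, when \<open>k = c\<close>; hence the condition that \<open>2 * k\<close> still occurs in \<open>N\<close>. In the
  other direction, distinctness of odd parts keeps \<open>2 * c + 1\<close> out of \<open>N\<close>, so the bound drops to
  \<open>2 * c\<close>.
\<close>

lemma shape_replace_top:
  assumes "c \<ge> 1" "count N 1 = c"
  shows "shape k (2 * c + 1) r (add_mset (2 * c + 1) N)
    \<longleftrightarrow> 2 * k \<in># N \<and> shape k (2 * c) r (add_mset (2 * c) N)"
    (is "?L \<longleftrightarrow> _ \<and> ?R")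
proof (intro iffI conjI; (elim conjE)?)
  assume L: ?L
  have ne: "2 * k \<noteq> 2 * c + 1" by presburger
  with L show "2 * k \<in># N" by (auto simp: shape_def)
  have "count (add_mset (2 * c + 1) N) (2 * c + 1) = 1"
    using L assms by (auto simp: shape_def)
  then have top: "2 * c + 1 \<notin># N" by (simp add: not_in_iff)
  have parts: "2 * k \<le> p \<and> p \<le> 2 * c \<and> (odd p \<longrightarrow> count (add_mset (2 * c) N) p = 1)"
    if "p \<in># N" "p > 1" for p
  proof -
    have "2 * k \<le> p \<and> p \<le> 2 * c + 1 \<and> (odd p \<longrightarrow> count (add_mset (2 * c + 1) N) p = 1)"
      using L that by (auto simp: shape_def)
    moreover have "p \<noteq> 2 * c + 1" using top that by auto
    ultimately show ?thesis by auto
  qed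
  show ?R
    using L assms parts \<open>2 * k \<in># N\<close> unfolding shape_def by simp
next
  assume k: "2 * k \<in># N" and R: ?R
  have parts: "2 * k \<le> p \<and> p \<le> 2 * c \<and> (odd p \<longrightarrow> count N p = 1)"
    if "p \<in># N" "p > 1" for p
  proof -
    have "2 * k \<le> p \<and> p \<le> 2 * c \<and> (odd p \<longrightarrow> count (add_mset (2 * c) N) p = 1)"
      using R that by (auto simp: shape_def)
    then show ?thesis by (auto split: if_splits)
  qed
  then have "2 * c + 1 \<notin># N" using assms(1) by force
  then have "count N (2 * c + 1) = 0" by (simp add: not_in_iff)
  moreover have "p \<noteq> 2 * c + 1" if "p \<in># N" for p
    using that \<open>2 * c + 1 \<notin># N\<close> by auto
  ultimately show ?L
    using R k assms parts unfolding shape_def by (auto simp: le_SucI)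
qed

text \<open>
  One more \<open>1\<close> moves the bound of the \<open>a2\<close>-family from \<open>2 * c\<close> to \<open>2 * c + 2\<close>, one above the bound
  \<open>2 * c + 1\<close> of the \<open>b2\<close>-family before. So only the part \<open>2 * c + 2\<close> separates the two conditions. Excluding
  it also excludes \<open>k = c + 1\<close>, as \<open>2 * k\<close> is a part.
\<close>

lemma shape_add_one:
  "shape k (2 * count P 1 + 2) r (add_mset 1 P) \<and> 2 * count P 1 + 2 \<notin># P
    \<longleftrightarrow> shape k (2 * count P 1 + 1) r P"
    (is "?L \<and> _ \<longleftrightarrow> ?R")
proof (intro iffI conjI; (elim conjE)?)
  assume L: ?L and top: "2 * count P 1 + 2 \<notin># P"
  have parts: "2 * k \<le> p \<and> p \<le> 2 * count P 1 + 1 \<and> (odd p \<longrightarrow> count P p = 1)"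
    if "p \<in># P" "p > 1" for p
  proof -
    have "2 * k \<le> p \<and> p \<le> 2 * count P 1 + 2 \<and> (odd p \<longrightarrow> count P p = 1)"
      using L that by (auto simp: shape_def)
    moreover have "p \<noteq> 2 * count P 1 + 2" using top that by auto
    ultimately show ?thesis by simp
  qed
  have k: "2 * k \<in># P" "k \<ge> 1" using L by (auto simp: shape_def)
  then have "k \<le> count P 1" using parts[of "2 * k"] by simp
  with k parts L show ?R
    unfolding shape_def by simp
next
  assume R: ?R
  then show ?L unfolding shape_def by (auto simp: le_SucI)
  show "2 * count P 1 + 2 \<notin># P"
  proof
    assume "2 * count P 1 + 2 \<in># P"
    with R have "2 * count P 1 + 2 \<le> 2 * count P 1 + 1"
      unfolding shape_def by fastforce
    then show False by simp
  qed
qed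

text \<open>
  What is left of a partition of \<open>n\<close> in the \<open>b2\<close>-family after its part \<open>2 * c + 1\<close> is removed, or,
  equally, of a partition of \<open>n - 1\<close> in the \<open>a2\<close>-family after a superfluous copy of \<open>2 * c\<close> is removed.
  Here \<open>c = count N 1\<close>.
\<close>

definition stem_set :: "nat \<Rightarrow> nat \<Rightarrow> nat multiset set" where
  "stem_set n r = {N. \<Sum>\<^sub># N + 2 * count N 1 + 1 = n \<and> count N 1 \<ge> 1 \<and>
     (\<exists>k. 2 * k \<in># N \<and> shape k (2 * count N 1) r (add_mset (2 * count N 1) N))}"

text \<open>
  The added part depends on the partition only through its number of ones, which the addition does
  not change; so this part is known from the result and can be removed again.
\<close>

lemma inj_on_add_top:
  assumes "\<And>c. c \<ge> 1 \<Longrightarrow> f c \<noteq> (1::nat)"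
  shows "inj_on (\<lambda>N. add_mset (f (count N 1)) N) {N. count N 1 \<ge> 1}"
proof (rule inj_onI)
  fix N N' :: "nat multiset"
  assume N: "N \<in> {N. count N 1 \<ge> 1}" "N' \<in> {N. count N 1 \<ge> 1}"
    and eq: "add_mset (f (count N 1)) N = add_mset (f (count N' 1)) N'"
  have "count N 1 = count (add_mset (f (count N 1)) N) 1"
    using N assms by simp
  also have "\<dots> = count N' 1"
    unfolding eq using N assms by simp
  finally show "N = N'" using eq by simp
qed

lemma B_set_with_top:
  "{M \<in> B_set n r. 2 * count M 1 + 1 \<in># M} = (\<lambda>N. add_mset (2 * count N 1 + 1) N) ` stem_set n r"
proof (intro equalityI subsetI)
  fix M assume "M \<in> {M \<in> B_set n r. 2 * count M 1 + 1 \<in># M}"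
  then obtain k where M: "\<Sum>\<^sub># M = n" "shape k (2 * count M 1 + 1) r M" "2 * count M 1 + 1 \<in># M"
    by (auto simp: B_set_def)
  then obtain N where N: "M = add_mset (2 * count M 1 + 1) N"
    by (metis insert_DiffM)
  have pos: "count M 1 \<ge> 1" using M(2) by (rule shape_count_1)
  then have c: "count M 1 = count N 1" by (subst N) simp
  have "N \<in> stem_set n r"
    using M N pos shape_replace_top[of "count N 1" N k r] unfolding stem_set_def c by auto
  with N c show "M \<in> (\<lambda>N. add_mset (2 * count N 1 + 1) N) ` stem_set n r" by auto
next
  fix M assume "M \<in> (\<lambda>N. add_mset (2 * count N 1 + 1) N) ` stem_set n r"
  then obtain N k where N: "M = add_mset (2 * count N 1 + 1) N" "\<Sum>\<^sub># N + 2 * count N 1 + 1 = n"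
    "count N 1 \<ge> 1" "2 * k \<in># N" "shape k (2 * count N 1) r (add_mset (2 * count N 1) N)"
    by (auto simp: stem_set_def)
  then have "shape k (2 * count N 1 + 1) r M" "count M 1 = count N 1"
    using shape_replace_top[of "count N 1" N k r] by auto
  with N show "M \<in> {M \<in> B_set n r. 2 * count M 1 + 1 \<in># M}"
    by (auto simp: B_set_def)
qed

lemma B_set_without_top: "{M \<in> B_set n r. 2 * count M 1 + 1 \<notin># M} = A_set n r"
proof -
  have "shape k (2 * c + 1) r M \<and> 2 * c + 1 \<notin># M \<longleftrightarrow> shape k (2 * c) r M"
    if "c \<ge> 1" for k c M
  proof -
    have "p \<le> 2 * c + 1 \<and> p \<noteq> 2 * c + 1 \<longleftrightarrow> p \<le> 2 * c" for p :: nat by auto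
    then have "(\<forall>p\<in>#M. p > 1 \<longrightarrow> 2 * k \<le> p \<and> p \<le> 2 * c + 1 \<and> (odd p \<longrightarrow> count M p = 1))
          \<and> 2 * c + 1 \<notin># M
        \<longleftrightarrow> (\<forall>p\<in>#M. p > 1 \<longrightarrow> 2 * k \<le> p \<and> p \<le> 2 * c \<and> (odd p \<longrightarrow> count M p = 1))"
      using that by fastforce
    then show ?thesis unfolding shape_def by argo
  qed
  then show ?thesis
    unfolding A_set_def B_set_def using shape_count_1 by blast
qed

text \<open>
  Without \<open>r \<ge> 1\<close> the partition into \<open>2 * c\<close> and \<open>c\<close> ones would be on the left but not on the right: its
  only part \<open>2 * c\<close> is compulsory.
\<close>

lemma A_set_with_top:
  assumes "r \<ge> 1"
  shows "{M \<in> A_set n r. 2 * count M 1 \<in># M} = (\<lambda>N. add_mset (2 * count N 1) N) ` stem_set (Suc n) r"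
proof (intro equalityI subsetI)
  fix M assume "M \<in> {M \<in> A_set n r. 2 * count M 1 \<in># M}"
  then obtain k where M: "\<Sum>\<^sub># M = n" "shape k (2 * count M 1) r M" "2 * count M 1 \<in># M"
    by (auto simp: A_set_def)
  then obtain N where N: "M = add_mset (2 * count M 1) N"
    by (metis insert_DiffM)
  have pos: "count M 1 \<ge> 1" using M(2) by (rule shape_count_1)
  then have c: "count M 1 = count N 1" by (subst N) simp
  have "2 * k \<in># N"
  proof (cases "k = count M 1")
    case False
    moreover have "2 * k \<in># add_mset (2 * count M 1) N"
      using M(2) N by (simp add: shape_def)
    ultimately show ?thesis by simp
  next
    case True
    \<comment> \<open>All parts above \<open>1\<close> now equal \<open>2 * k\<close>, and \<open>r \<ge> 1\<close> provides a second one.\<close>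
    have "size {#p \<in># add_mset (2 * count M 1) N. p > 1#} = Suc r"
      using M(2) N by (simp add: shape_def)
    then have "size {#p \<in># N. p > 1#} \<ge> 1"
      using assms by (simp split: if_splits)
    then have "{#p \<in># N. p > 1#} \<noteq> {#}" by (metis not_one_le_zero size_empty)
    then obtain p where "p \<in># {#p \<in># N. p > 1#}"
      by (rule multiset_nonemptyE)
    then have "p \<in># N" "p > 1" by simp_all
    moreover from this have "p \<in># M" by (subst N) simp
    ultimately show ?thesis
      using M(2) True unfolding shape_def by (metis order_antisym)
  qed
  then have "N \<in> stem_set (Suc n) r"
    using M N pos unfolding stem_set_def c by auto
  with N c show "M \<in> (\<lambda>N. add_mset (2 * count N 1) N) ` stem_set (Suc n) r" by auto
next
  fix M assume "M \<in> (\<lambda>N. add_mset (2 * count N 1) N) ` stem_set (Suc n) r"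
  then obtain N k where N: "M = add_mset (2 * count N 1) N" "\<Sum>\<^sub># N + 2 * count N 1 = n"
    "count N 1 \<ge> 1" "shape k (2 * count N 1) r (add_mset (2 * count N 1) N)"
    by (auto simp: stem_set_def)
  then have "count M 1 = count N 1" by auto
  with N show "M \<in> {M \<in> A_set n r. 2 * count M 1 \<in># M}"
    by (auto simp: A_set_def)
qed

lemma A_set_without_top:
  "{M \<in> A_set (Suc n) r. 2 * count M 1 \<notin># M} = add_mset 1 ` B_set n r"
proof (intro equalityI subsetI)
  fix M assume "M \<in> {M \<in> A_set (Suc n) r. 2 * count M 1 \<notin># M}"
  then obtain k where M: "\<Sum>\<^sub># M = Suc n" "shape k (2 * count M 1) r M" "2 * count M 1 \<notin># M"
    by (auto simp: A_set_def)
  then have "1 \<in># M" by (auto simp: shape_def simp flip: count_greater_zero_iff)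
  then obtain P where P: "M = add_mset 1 P"
    by (metis insert_DiffM)
  have "shape k (2 * count P 1 + 1) r P"
    using M P shape_add_one[of k P r] by simp
  then show "M \<in> add_mset 1 ` B_set n r"
    using M P by (auto simp: B_set_def)
next
  fix M assume "M \<in> add_mset 1 ` B_set n r"
  then obtain P k where P: "M = add_mset 1 P" "\<Sum>\<^sub># P = n" "shape k (2 * count P 1 + 1) r P"
    by (auto simp: B_set_def)
  then show "M \<in> {M \<in> A_set (Suc n) r. 2 * count M 1 \<notin># M}"
    using shape_add_one[of k P r] by (auto simp: A_set_def)
qed

section \<open>The recurrence for positive r\<close>

lemma card_split:
  assumes "finite S"
  shows "card S = card {x \<in> S. P x} + card {x \<in> S. \<not> P x}"
proof -
  have "S = {x \<in> S. P x} \<union> {x \<in> S. \<not> P x}" by blast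
  then show ?thesis
    using assms by (subst (1) \<open>S = _\<close>, subst card_Un_disjoint) auto
qed

lemma b2_eq_a2_plus_stem: "b2 n r = a2 n r + card (stem_set n r)"
proof -
  have "inj_on (\<lambda>N. add_mset (2 * count N 1 + 1) N) (stem_set n r)"
    by (rule inj_on_subset[OF inj_on_add_top[of "\<lambda>c. 2 * c + 1"]]) (auto simp: stem_set_def)
  then show ?thesis
    unfolding a2_eq_card b2_eq_card
      card_split[OF finite_B_set, of n r "\<lambda>M. 2 * count M 1 + 1 \<in># M"]
      B_set_with_top B_set_without_top
    by (simp add: card_image)
qed

lemma a2_eq_b2_plus_stem:
  assumes "r \<ge> 1"
  shows "a2 (Suc n) r = b2 n r + card (stem_set (n + 2) r)"
proof -
  have "inj_on (\<lambda>N. add_mset (2 * count N 1) N) (stem_set (Suc (Suc n)) r)"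
    by (rule inj_on_subset[OF inj_on_add_top[of "\<lambda>c. 2 * c"]]) (auto simp: stem_set_def)
  moreover have "inj_on (add_mset 1) (B_set n r)" by (simp add: inj_on_def)
  ultimately show ?thesis
    unfolding a2_eq_card b2_eq_card
      card_split[OF finite_A_set, of "Suc n" r "\<lambda>M. 2 * count M 1 \<in># M"]
      A_set_with_top[OF assms] A_set_without_top
    by (simp add: card_image)
qed

lemma a2_b2_relation:
  assumes "r \<ge> 1"
  shows "b2_int (int n) r + b2_int (int n - 2) r = a2_int (int n) r + a2_int (int n - 1) r"
proof (cases "n < 2")
  case True
  then show ?thesis
    by (auto simp: a2_int_def b2_int_def a2_eq_0 b2_eq_0)
next
  case False
  then obtain m where n: "n = m + 2" by (metis add.commute le_Suc_ex not_less)
  have "b2_int (int n) r = b2 n r" "b2_int (int n - 2) r = b2 m r"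
    "a2_int (int n) r = a2 n r" "a2_int (int n - 1) r = a2 (Suc m) r"
    unfolding a2_int_def b2_int_def n by (simp_all add: nat_add_distrib nat_diff_distrib)
  then show ?thesis
    using a2_eq_b2_plus_stem[OF assms, of m] b2_eq_a2_plus_stem[of n r] n by simp
qed

section \<open>The case r = 0\<close>

lemma shape_0_iff:
  "shape k u 0 M \<longleftrightarrow>
     (\<exists>c. 1 \<le> k \<and> k \<le> c \<and> 2 * k \<le> u \<and> M = add_mset (2 * k) (replicate_mset c 1))"
proof
  assume M: "shape k u 0 M"
  let ?c = "count M 1"
  have sz: "size {#p \<in># M. p > 1#} = 1" and k: "1 \<le> k" "k \<le> ?c" "2 * k \<in># {#p \<in># M. p > 1#}"
    and nz: "0 \<notin># M"
    using M by (auto simp: shape_def)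
  from sz obtain x where "{#p \<in># M. p > 1#} = {#x#}" using size_1_singleton_mset by metis
  with k(3) have 1: "{#p \<in># M. p > 1#} = {#2 * k#}"
    by (simp only: set_mset_single set_mset_add_mset_insert singleton_iff set_mset_empty)
  have "{#p \<in># M. \<not> p > 1#} = {#p \<in># M. 1 = p#}"
    using nz by (intro filter_mset_cong) (auto, metis less_one linorder_neqE_nat One_nat_def)
  also have "\<dots> = replicate_mset ?c 1" by (simp add: multiset_eq_iff)
  finally have "M = add_mset (2 * k) (replicate_mset ?c 1)"
    using multiset_partition[of M "\<lambda>p. p > 1"] 1 by simp
  moreover have "2 * k \<le> u" using M by (auto simp: shape_def)
  ultimately show "\<exists>c. 1 \<le> k \<and> k \<le> c \<and> 2 * k \<le> u \<and> M = add_mset (2 * k) (replicate_mset c 1)"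
    using k by blast
next
  assume "\<exists>c. 1 \<le> k \<and> k \<le> c \<and> 2 * k \<le> u \<and> M = add_mset (2 * k) (replicate_mset c 1)"
  then obtain c where c: "1 \<le> k" "k \<le> c" "2 * k \<le> u" "M = add_mset (2 * k) (replicate_mset c 1)"
    by blast
  have "{#p \<in># replicate_mset c (1::nat). p > 1#} = {#}" by (induction c) auto
  with c show "shape k u 0 M"
    unfolding shape_def by auto
qed

text \<open>
  The sum \<open>n = 2 * k + c\<close> determines \<open>c\<close> from \<open>k\<close>, and turns \<open>k \<le> c\<close> into \<open>3 * k \<le> n\<close>; so \<open>k\<close> runs
  through \<open>1, \<dots>, n div 3\<close>. The bound \<open>f c\<close> stands for both \<open>2 * c\<close> and \<open>2 * c + 1\<close>.
\<close>

lemma card_shape_0: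
  assumes "\<And>c. 2 * c \<le> f c"
  shows "card {M. \<Sum>\<^sub># M = n \<and> (\<exists>k. shape k (f (count M 1)) 0 M)} = n div 3"
proof -
  define g where "g k = add_mset (2 * k) (replicate_mset (n - 2 * k) 1)" for k :: nat
  have "{M. \<Sum>\<^sub># M = n \<and> (\<exists>k. shape k (f (count M 1)) 0 M)} = g ` {1..n div 3}"
  proof (intro equalityI subsetI)
    fix M assume "M \<in> {M. \<Sum>\<^sub># M = n \<and> (\<exists>k. shape k (f (count M 1)) 0 M)}"
    then obtain k c where "\<Sum>\<^sub># M = n" "1 \<le> k" "k \<le> c" "M = add_mset (2 * k) (replicate_mset c 1)"
      by (auto simp: shape_0_iff)
    then show "M \<in> g ` {1..n div 3}"
      unfolding g_def by (intro image_eqI[of _ _ k]) (auto simp: sum_mset_replicate_mset)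
  next
    fix M assume "M \<in> g ` {1..n div 3}"
    then obtain k where k: "1 \<le> k" "k \<le> n div 3" "M = g k" by auto
    then have "3 * k \<le> n" by linarith
    moreover have "count M 1 = n - 2 * k" using k by (auto simp: g_def)
    moreover have "2 * k \<le> f (n - 2 * k)"
      using assms[of "n - 2 * k"] \<open>3 * k \<le> n\<close> by linarith
    ultimately have "shape k (f (count M 1)) 0 M"
      unfolding shape_0_iff using k by (auto simp: g_def intro!: exI[of _ "n - 2 * k"])
    moreover have "\<Sum>\<^sub># M = n"
      using k \<open>3 * k \<le> n\<close> by (simp add: g_def sum_mset_replicate_mset)
    ultimately show "M \<in> {M. \<Sum>\<^sub># M = n \<and> (\<exists>k. shape k (f (count M 1)) 0 M)}" by blast
  qed
  moreover have "inj_on g {1..n div 3}"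
  proof (rule inj_onI)
    fix k k' assume k: "k \<in> {1..n div 3}" "k' \<in> {1..n div 3}" "g k = g k'"
    then have "2 * k \<in># g k'" by (metis g_def union_single_eq_member)
    with k show "k = k'" by (auto simp: g_def in_replicate_mset split: if_splits)
  qed
  ultimately show ?thesis by (simp add: card_image)
qed

lemma a2_0: "a2 n 0 = n div 3"
  using card_shape_0[of "\<lambda>c. 2 * c"] by (simp add: a2_eq_card A_set_def)

lemma b2_0: "b2 n 0 = n div 3"
  using card_shape_0[of "\<lambda>c. 2 * c + 1"] by (simp add: b2_eq_card B_set_def)

section \<open>Generating functions\<close>

text \<open>
  Multiplying by \<open>1 - fps_X ^ 3\<close> takes the difference \<open>n div 3 - (n - 3) div 3 = 1\<close> for \<open>n \<ge> 3\<close>, and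
  multiplying by \<open>1 - fps_X\<close> then leaves only the jump at \<open>3\<close>.
\<close>

lemma gf_div_3:
  includes fps_syntax
  shows "Abs_fps (\<lambda>n. of_nat (n div 3)) =
     (fps_X ^ 3 / ((1 - fps_X) * (1 - fps_X ^ 3)) :: 'a :: field fps)"
proof -
  let ?F = "Abs_fps (\<lambda>n. of_nat (n div 3)) :: 'a fps"
  let ?G = "Abs_fps (\<lambda>n. if n < 3 then 0 else 1) :: 'a fps"
  have "?F * (1 - fps_X ^ 3) = ?G"
  proof (rule fps_ext)
    fix n
    show "(?F * (1 - fps_X ^ 3)) $ n = ?G $ n"
      by (cases "n < 3")
        (auto simp: right_diff_distrib fps_X_power_mult_right_nth le_div_geq not_less)
  qed
  moreover have "?G * (1 - fps_X) = fps_X ^ 3"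
  proof (rule fps_ext)
    fix n
    show "(?G * (1 - fps_X)) $ n = (fps_X ^ 3 :: 'a fps) $ n"
      by (cases "n = 0") (auto simp: right_diff_distrib fps_X_power_nth)
  qed
  ultimately have "?F * (1 - fps_X ^ 3) * (1 - fps_X) = fps_X ^ 3"
    by (simp only:)
  then have *: "?F * ((1 - fps_X) * (1 - fps_X ^ 3)) = fps_X ^ 3"
    by (simp only: mult_ac)
  have "((1 - fps_X) * (1 - fps_X ^ 3) :: 'a fps) $ 0 \<noteq> 0"
    by simp
  then have nz: "(1 - fps_X) * (1 - fps_X ^ 3) \<noteq> (0 :: 'a fps)" by (metis fps_zero_nth)
  have "?F = ?F * ((1 - fps_X) * (1 - fps_X ^ 3)) / ((1 - fps_X) * (1 - fps_X ^ 3))"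
    using nonzero_mult_div_cancel_right[OF nz] by (rule sym)
  also have "\<dots> = fps_X ^ 3 / ((1 - fps_X) * (1 - fps_X ^ 3))"
    by (rule arg_cong[OF *])
  finally show ?thesis .
qed

lemma B_A_relation:
  includes fps_syntax
  assumes "r \<ge> 1"
  shows "(1 + fps_X ^ 2) * B r = (1 + fps_X) * A r"
proof (rule fps_ext)
  fix n
  have "of_nat (b2_int (int n) r) + of_nat (b2_int (int n - 2) r)
      = (of_nat (a2_int (int n) r) + of_nat (a2_int (int n - 1) r) :: rat)"
    using a2_b2_relation[OF assms, of n] by (metis of_nat_add)
  moreover have "((1 + fps_X ^ 2) * B r) $ n = of_nat (b2_int (int n) r) + of_nat (b2_int (int n - 2) r)"
    by (auto simp: distrib_right fps_X_power_mult_nth B_def b2_int_def nat_diff_distrib)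
  moreover have "((1 + fps_X) * A r) $ n = of_nat (a2_int (int n) r) + of_nat (a2_int (int n - 1) r)"
    by (auto simp: distrib_right A_def a2_int_def nat_diff_distrib)
  ultimately show "((1 + fps_X ^ 2) * B r) $ n = ((1 + fps_X) * A r) $ n" by simp
qed

theorem corollary3:
  shows "A 0 = fps_X ^ 3 / ((1 - fps_X) * (1 - fps_X ^ 3))
    \<and> B 0 = fps_X ^ 3 / ((1 - fps_X) * (1 - fps_X ^ 3))
    \<and> (\<forall>r\<ge>1. (1 + fps_X ^ 2) * B r = (1 + fps_X) * A r)
    \<and> (\<forall>r\<ge>1. \<forall>n::nat. b2_int (int n) r + b2_int (int n - 2) r
                      = a2_int (int n) r + a2_int (int n - 1) r)"
  using B_A_relation a2_b2_relation by (simp add: A_def B_def a2_0 b2_0 gf_div_3)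

end
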